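(* Let $g$ satisfy the standing assumptions, let $\lambda>0$, and let the step size $s>0$ satisfy $s\le\min\{\frac{2\lambda}{G^2},\frac1L\}$. The sequence $\{X^t\}_{t=1}^\infty\subset\mathbb{R}^{n\times k}$ generated by the non-monotone accelerated proximal gradient descent with support projection (defined in the context) satisfies $$\mathrm{supp}(\sigma(X^{t+1}))\subseteq\mathrm{supp}(\sigma(X^t)),\quad t\ge1.$$
   Context: Standing assumptions: $g:\mathbb{R}^{n\times k}\to\mathbb{R}$ is convex and differentiable; the largest singular value of its gradient is bounded, $\sigma_{\max}(\nabla g(X))\le G$ for all $X$; and $\nabla g$ is $L$-Lipschitz, $\|\nabla g(X_1)-\nabla g(X_2)\|_F\le L\|X_1-X_2\|_F$ for all $X_1,X_2$ ($G,L>0$, $\|\cdot\|_F$ the Frobenius norm). The problem being solved is $\min_X F(X)=g(X)+\lambda\,\mathrm{rank}(X)$. Notation: $\sigma(X)$ is the vector of the $\min(n,k)$ singular values of $X$ in non-increasing order; $\mathrm{supp}(v)$ is the set of indices of nonzero entries of a vector $v$. Superscripts on matrices and on $\alpha$ denote the iteration, except that $(\alpha^t)^2$ is the square of $\alpha^t$. Singular value hard thresholding: for $\theta\ge0$ and a singular value decomposition $Q=U\Sigma V^T$, $T_\theta(Q)=U\Sigma_\theta V^T$, where $\Sigma_\theta(i,i)=0$ if $|\Sigma(i,i)|\le\theta$ and $\Sigma_\theta(i,i)=\Sigma(i,i)$ otherwise. Support projection: for a set of indices $I$ and a matrix $T$ with singular value decomposition $T=A\Sigma B^T$ (singular values in non-increasing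 order), $P_I(T)=A\Sigma_{\mathrm{projected}}B^T$, where $\Sigma_{\mathrm{projected}}(i,i)=\Sigma(i,i)$ if $i\in I$ and $0$ otherwise. Algorithm (non-monotone accelerated proximal gradient descent with support projection): given $X^0$, set $X^1=X^0$, $\alpha^0=1$, and $\alpha^{t+1}=\frac{\sqrt{1+4(\alpha^t)^2}+1}{2}$ for $t\ge0$. For $t=1,2,\dots$: $$U^t=X^t+\frac{\alpha^{t-1}-1}{\alpha^t}(X^t-X^{t-1}),\quad V^t=P_{\mathrm{supp}(\sigma(X^t))}(U^t),\quad X^{t+1}=T_{\sqrt{2\lambda s}}\big(V^t-s\nabla g(V^t)\big).$$ *)

theory Defs
  imports "HOL-Analysis.Analysis"
begin

text \<open>
  An \<open>n \<times> k\<close> real matrix is an element of \<open>real ^ 'k ^ 'n\<close>. On this type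
  \<open>norm\<close>, \<open>dist\<close> and the inner product are the Frobenius ones, so that
  \<open>GDERIV g X :> D\<close> says that \<open>D\<close> is the matrix gradient of \<open>g\<close> at \<open>X\<close>.
  Vectors of singular values are lists, and their indices start at 0.
\<close>

text \<open>
  Rows and columns are numbered by the library's bijection between a finite type
  and \<open>{..<CARD('a)}\<close>; only with such a numbering does a rectangular matrix have a
  diagonal. Which numbering is used is immaterial, since another one only permutes the
  columns of the orthogonal factors of a singular value decomposition.
\<close>

definition idx :: "'a::finite \<Rightarrow> nat" where
  "idx = to_nat_on UNIV"

definition rect_diag :: "real list \<Rightarrow> real ^ 'k ^ 'n" where
  "rect_diag d = (\<chi> i j. if idx i = idx j then d ! idx i else 0)"

definition is_svd ::
    "real ^ 'k ^ 'n \<Rightarrow> real ^ 'n ^ 'n \<Rightarrow> real list \<Rightarrow> real ^ 'k ^ 'k \<Rightarrow> bool" where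
  "is_svd Q U d V \<longleftrightarrow>
     orthogonal_matrix U \<and> orthogonal_matrix V \<and>
     length d = min CARD('n) CARD('k) \<and> (\<forall>x \<in> set d. 0 \<le> x) \<and>
     Q = U ** rect_diag d ** transpose V"

definition singular_values :: "real ^ 'k ^ 'n \<Rightarrow> real list" where
  "singular_values X = (THE d. sorted_wrt (\<ge>) d \<and> (\<exists>U V. is_svd X U d V))"

definition sigma_max :: "real ^ 'k ^ 'n \<Rightarrow> real" where
  "sigma_max X = Max (set (singular_values X))"

definition supp :: "real list \<Rightarrow> nat set" where
  "supp v = {i. i < length v \<and> v ! i \<noteq> 0}"

text \<open>
  The next two operations depend on a singular value decomposition and are therefore
  relations: \<open>Y\<close> results from \<open>Q\<close> (or \<open>T\<close>) for some choice of it. For thresholding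
  the choice does not matter; for the projection it does if the index set \<open>I\<close> separates
  equal singular values.
\<close>

definition hard_threshold :: "real \<Rightarrow> real ^ 'k ^ 'n \<Rightarrow> real ^ 'k ^ 'n \<Rightarrow> bool" where
  "hard_threshold \<theta> Q Y \<longleftrightarrow>
     (\<exists>U d V. is_svd Q U d V \<and>
        Y = U ** rect_diag (map (\<lambda>x. if \<bar>x\<bar> \<le> \<theta> then 0 else x) d) ** transpose V)"

definition support_proj :: "nat set \<Rightarrow> real ^ 'k ^ 'n \<Rightarrow> real ^ 'k ^ 'n \<Rightarrow> bool" where
  "support_proj I T Y \<longleftrightarrow>
     (\<exists>A d B. is_svd T A d B \<and> sorted_wrt (\<ge>) d \<and>
        Y = A ** rect_diag (map (\<lambda>i. if i \<in> I then d ! i else 0) [0..<length d]) ** transpose B)"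

primrec apg_alpha :: "nat \<Rightarrow> real" where
  "apg_alpha 0 = 1"
| "apg_alpha (Suc t) = (sqrt (1 + 4 * (apg_alpha t)\<^sup>2) + 1) / 2"

text \<open>
  The iterates \<open>X\<close> of non-monotone accelerated proximal gradient descent with support
  projection, for arbitrary choices of the decompositions in every step. The starting point
  is \<open>X 0\<close>.
\<close>

definition apg_support_proj_seq ::
    "(real ^ 'k ^ 'n \<Rightarrow> real ^ 'k ^ 'n) \<Rightarrow> real \<Rightarrow> real \<Rightarrow> (nat \<Rightarrow> real ^ 'k ^ 'n) \<Rightarrow> bool" where
  "apg_support_proj_seq grad lam s X \<longleftrightarrow>
     X 1 = X 0 \<and>
     (\<forall>t\<ge>1. \<exists>U V.
        U = X t + ((apg_alpha (t - 1) - 1) / apg_alpha t) *\<^sub>R (X t - X (t - 1)) \<and>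
        support_proj (supp (singular_values (X t))) U V \<and>
        hard_threshold (sqrt (2 * lam * s)) (V - s *\<^sub>R grad V) (X (t + 1)))"

end

theory Submission
  imports Defs
begin

text \<open>
  Non-increasing singular values make \<open>supp (singular_values X)\<close> the initial segment
  \<open>{..<r}\<close>, where \<open>r\<close> is the rank of \<open>X\<close>. So the claim is that the rank does not
  increase along the iteration. Let \<open>W\<close> be the projected point of step \<open>t\<close> and \<open>D = s \<nabla>g(W)\<close>.
  The projection keeps at most \<open>r = rank (X t)\<close> singular values, hence \<open>rank W \<le> r\<close>. The bound
  \<open>s \<le> 2\<lambda>/G\<^sup>2\<close> says exactly that \<open>s G \<le> \<theta>\<close> for the threshold \<open>\<theta> = sqrt (2\<lambda>s)\<close>, so
  \<open>D\<close> stretches no vector by more than \<open>\<theta>\<close>. Weyl's inequality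
  \<open>\<sigma>\<^bsub>r+1\<^esub>(W - D) \<le> \<sigma>\<^bsub>r+1\<^esub>(W) + \<sigma>\<^sub>1(D) \<le> \<theta>\<close> then shows that thresholding leaves at most
  \<open>r\<close> singular values of \<open>W - D\<close>.

  Everything about singular values rests on one variational fact: the number of singular
  values above \<open>c \<ge> 0\<close> is the largest dimension of a subspace on which the matrix
  stretches every nonzero vector by more than \<open>c\<close> (\<open>dim_le_count_above\<close> and
  \<open>ex_subspace_count_above\<close>). The right-hand side does not mention a decomposition, so this makes
  the sorted list of singular values unique. It also gives the needed case of Weyl's inequality
  (\<open>count_above_perturbation_le\<close>): where \<open>W - D\<close> stretches by more than \<open>\<theta>\<close> and \<open>D\<close> by at most
  \<open>\<theta>\<close>, the matrix \<open>W\<close> cannot vanish.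

  A description of \<open>singular_values\<close> also needs the existence of a singular value decomposition.
  Singular pairs are split off one at a time by maximizing the bilinear form \<open>a \<bullet> X b\<close> over
  unit vectors orthogonal to those already found (\<open>ex_singular_pair\<close>).
\<close>

section \<open>Numbering of rows and columns\<close>

text \<open>
  The factor \<open>transpose V *v x\<close> holds the coordinates of \<open>x\<close> in the right singular vectors; it should
  not be rewritten to \<open>x v* V\<close>.
\<close>

declare transpose_matrix_vector [simp del]

lemma bij_betw_idx: "bij_betw (idx :: 'a::finite \<Rightarrow> nat) UNIV {..<CARD('a)}"
  unfolding idx_def using to_nat_on_finite[of "UNIV :: 'a set"] by simp

lemma idx_less: "idx (i :: 'a::finite) < CARD('a)"
  using bij_betw_idx[where 'a='a] by (auto simp: bij_betw_def)

lemma idx_eq_iff [simp]: "idx (i :: 'a::finite) = idx j \<longleftrightarrow> i = j"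
  using bij_betw_idx[where 'a='a] by (auto simp: bij_betw_def inj_on_def)

lemma idx_surj:
  assumes "t < CARD('a)"
  obtains i :: "'a::finite" where "idx i = t"
proof -
  have "t \<in> range (idx :: 'a \<Rightarrow> nat)"
    using bij_betw_imp_surj_on[OF bij_betw_idx[where 'a='a]] assms by simp
  then show thesis using that by (rule imageE) simp
qed

section \<open>Counting the entries above a level\<close>

definition count_above :: "real \<Rightarrow> real list \<Rightarrow> nat" where
  "count_above c d = card {i. i < length d \<and> c < d ! i}"

lemma card_idx_above:
  assumes "length d \<le> CARD('k::finite)"
  shows "card {j :: 'k. idx j < length d \<and> c < d ! idx j} = count_above c d"
proof -
  have "idx ` {j :: 'k. idx j < length d \<and> c < d ! idx j} = {i. i < length d \<and> c < d ! i}"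
  proof safe
    fix i assume "i < length d" "c < d ! i"
    then have "i < CARD('k)" using assms by simp
    then obtain j :: 'k where "idx j = i" by (rule idx_surj)
    then show "i \<in> idx ` {j :: 'k. idx j < length d \<and> c < d ! idx j}"
      using \<open>i < length d\<close> \<open>c < d ! i\<close> by auto
  qed
  moreover have "inj_on idx {j :: 'k. idx j < length d \<and> c < d ! idx j}"
    by (rule inj_onI) simp
  ultimately show ?thesis
    unfolding count_above_def using card_image by force
qed

lemma sorted_above_eq:
  assumes "sorted_wrt (\<ge>) d"
  shows "{i. i < length d \<and> c < d ! i} = {..<count_above c d}"
proof -
  let ?A = "{i. i < length d \<and> c < d ! i}"
  have down: "j \<in> ?A" if "i \<in> ?A" "j \<le> i" for i j
  proof (cases "j = i")
    case False
    then have "d ! j \<ge> d ! i"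
      using that assms by (auto simp: sorted_wrt_iff_nth_less)
    then show ?thesis using that by auto
  qed (use that in auto)
  have "finite ?A" by simp
  then have "?A = {..<card ?A}"
  proof (cases "?A = {}")
    case False
    then have "Max ?A \<in> ?A" using \<open>finite ?A\<close> by (rule Max_in[rotated])
    then have "?A = {..Max ?A}"
      using down Max_ge[OF \<open>finite ?A\<close>] by blast
    then show ?thesis
      by (metis card_atMost lessThan_Suc_atMost)
  next
    case True
    then show ?thesis by (simp only: card.empty lessThan_0)
  qed
  then show ?thesis unfolding count_above_def .
qed

text \<open>
  A sorted list of nonnegative numbers can be recovered from its counts: entry \<open>i\<close> exceeds \<open>c\<close>
  if and only if more than \<open>i\<close> entries do. Levels \<open>c \<ge> 0\<close> suffice since each of the two
  entries compared can itself serve as the level.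
\<close>

lemma sorted_eq_if_count_above_eq:
  assumes "sorted_wrt (\<ge>) d" "sorted_wrt (\<ge>) e" "length d = length e"
    and "\<forall>x\<in>set d. 0 \<le> x" "\<forall>x\<in>set e. 0 \<le> x"
    and "\<And>c. 0 \<le> c \<Longrightarrow> count_above c d = count_above c e"
  shows "d = e"
proof (rule nth_equalityI)
  fix i assume i: "i < length d"
  have iff: "c < d ! i \<longleftrightarrow> c < e ! i" if "0 \<le> c" for c
  proof -
    have "i \<in> {i. i < length d \<and> c < d ! i} \<longleftrightarrow> i \<in> {i. i < length e \<and> c < e ! i}"
      by (simp only: sorted_above_eq[OF assms(1)] sorted_above_eq[OF assms(2)] assms(6)[OF that])
    then show ?thesis using i assms(3) by simp
  qed
  have "0 \<le> d ! i" "0 \<le> e ! i" using i assms(3-5) by auto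
  then show "d ! i = e ! i"
    using iff[of "d ! i"] iff[of "e ! i"] by linarith
qed (rule assms(3))

section \<open>Stretching in singular coordinates\<close>

lemma norm_square_sum: "(norm (y :: real ^ 'k))\<^sup>2 = (\<Sum>j\<in>UNIV. (y $ j)\<^sup>2)"
  unfolding power2_norm_eq_inner by (simp add: inner_vec_def power2_eq_square)

text \<open>
  Each row of \<open>rect_diag d\<close> has at most one nonzero entry, so the square of a component of the product
  is itself a sum over the columns, and the two sums can be exchanged.
\<close>

lemma norm_rect_diag_mult:
  fixes y :: "real ^ 'k"
  assumes "length d = min CARD('n::finite) CARD('k)"
  shows "(norm ((rect_diag d :: real ^ 'k ^ 'n) *v y))\<^sup>2 =
    (\<Sum>j\<in>UNIV. (if idx j < length d then (d ! idx j)\<^sup>2 else 0) * (y $ j)\<^sup>2)"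
proof -
  have square: "((rect_diag d *v y) $ i)\<^sup>2 =
      (\<Sum>j\<in>UNIV. if idx j = idx i then (d ! idx j)\<^sup>2 * (y $ j)\<^sup>2 else 0)" for i :: 'n
  proof (cases "\<exists>j0 :: 'k. idx j0 = idx i")
    case True
    then obtain j0 :: 'k where j0: "idx i = idx j0" by metis
    show ?thesis
      by (simp add: matrix_vector_mult_def rect_diag_def j0 if_distrib[of "\<lambda>x. x * _"] power_mult_distrib
          sum.delta sum.delta' cong: if_cong)
  next
    case False
    then have "idx j \<noteq> idx i" "idx i \<noteq> idx j" for j :: 'k by metis+
    then show ?thesis by (simp add: matrix_vector_mult_def rect_diag_def)
  qed
  have "(norm ((rect_diag d :: real ^ 'k ^ 'n) *v y))\<^sup>2 = (\<Sum>i\<in>UNIV. ((rect_diag d *v y) $ (i :: 'n))\<^sup>2)"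
    by (rule norm_square_sum)
  also have "\<dots> = (\<Sum>j\<in>UNIV. \<Sum>i\<in>(UNIV :: 'n set).
      if idx j = idx i then (d ! idx j)\<^sup>2 * (y $ j)\<^sup>2 else 0)"
    unfolding square by (rule sum.swap)
  also have "\<dots> = (\<Sum>j\<in>UNIV. (if idx j < length d then (d ! idx j)\<^sup>2 else 0) * (y $ j)\<^sup>2)"
  proof (rule sum.cong[OF refl])
    fix j :: 'k
    show "(\<Sum>i\<in>(UNIV :: 'n set). if idx j = idx i then (d ! idx j)\<^sup>2 * (y $ j)\<^sup>2 else 0) =
      (if idx j < length d then (d ! idx j)\<^sup>2 else 0) * (y $ j)\<^sup>2"
    proof (cases "idx j < CARD('n)")
      case True
      then obtain i0 :: 'n where "idx i0 = idx j" by (rule idx_surj)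
      then show ?thesis using True assms idx_less[of j] by (simp flip: \<open>idx i0 = idx j\<close>)
    next
      case False
      then have "idx j \<noteq> idx i" for i :: 'n using idx_less[of i] by metis
      then show ?thesis using False assms by simp
    qed
  qed
  finally show ?thesis .
qed

lemma norm_orthogonal_matrix_mult:
  fixes U :: "real ^ 'n ^ 'n"
  assumes "orthogonal_matrix U"
  shows "norm (U *v x) = norm x"
proof -
  have "orthogonal_transformation ((*v) U)"
    using assms by (simp add: orthogonal_transformation_matrix)
  then show ?thesis by (rule orthogonal_transformation_norm)
qed

lemma norm_svd_mult:
  fixes X :: "real ^ 'k ^ 'n"
  assumes "is_svd X U d V"
  shows "(norm (X *v x))\<^sup>2 =
    (\<Sum>j\<in>UNIV. (if idx j < length d then (d ! idx j)\<^sup>2 else 0) * ((transpose V *v x) $ j)\<^sup>2)"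
proof -
  have "X *v x = U *v (rect_diag d *v (transpose V *v x))"
    using assms by (simp add: is_svd_def matrix_vector_mul_assoc matrix_mul_assoc)
  then have "norm (X *v x) = norm ((rect_diag d :: real ^ 'k ^ 'n) *v (transpose V *v x))"
    using assms by (simp add: is_svd_def norm_orthogonal_matrix_mult)
  then show ?thesis using assms by (simp add: is_svd_def norm_rect_diag_mult)
qed

text \<open>
  The norm formula shows that \<open>X\<close> stretches \<open>x\<close> at most by the largest singular value whose
  right singular vector contributes to \<open>x\<close>.
\<close>

lemma norm_svd_mult_le:
  fixes X :: "real ^ 'k ^ 'n"
  assumes svd: "is_svd X U d V" and "0 \<le> c"
    and le: "\<And>j. (transpose V *v x) $ j \<noteq> 0 \<Longrightarrow> idx j < length d \<Longrightarrow> d ! idx j \<le> c"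
  shows "norm (X *v x) \<le> c * norm x"
proof -
  let ?y = "transpose V *v x"
  have V: "orthogonal_matrix (transpose V)" and nonneg: "\<forall>x\<in>set d. 0 \<le> x"
    using svd by (auto simp: is_svd_def orthogonal_matrix_transpose)
  have "(norm (X *v x))\<^sup>2 \<le> (\<Sum>j\<in>UNIV. c\<^sup>2 * (?y $ j)\<^sup>2)"
    unfolding norm_svd_mult[OF svd]
  proof (rule sum_mono)
    fix j
    show "(if idx j < length d then (d ! idx j)\<^sup>2 else 0) * (?y $ j)\<^sup>2 \<le> c\<^sup>2 * (?y $ j)\<^sup>2"
    proof (cases "?y $ j = 0")
      case False
      then show ?thesis using nonneg le[of j] by (auto intro!: mult_right_mono power_mono)
    qed simp
  qed
  also have "\<dots> = (c * norm x)\<^sup>2"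
    using norm_square_sum[of ?y] norm_orthogonal_matrix_mult[OF V, of x]
    by (simp add: sum_distrib_left[symmetric] power_mult_distrib)
  finally show ?thesis
    using \<open>0 \<le> c\<close> by (meson mult_nonneg_nonneg norm_ge_zero power2_le_imp_le)
qed

section \<open>The variational characterization of the counts\<close>

lemma dim_coordinate_subspace:
  "dim {y :: real ^ 'k. \<forall>j. j \<notin> J \<longrightarrow> y $ j = 0} = card J"
  using dim_substandard_cart[where 'a=real and 'n='k and d=J] by (simp add: dim_vec_eq)

text \<open>
  The upper bound comes from the coordinates along singular vectors with value above \<open>c\<close>. Keeping
  only these is injective on \<open>S\<close>: a vector for which they all vanish is stretched by at most \<open>c\<close>.
\<close>

lemma dim_le_count_above:
  fixes X :: "real ^ 'k ^ 'n"
  assumes svd: "is_svd X U d V" and "0 \<le> c" and "subspace S"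
    and large: "\<And>x. x \<in> S \<Longrightarrow> x \<noteq> 0 \<Longrightarrow> c * norm x < norm (X *v x)"
  shows "dim S \<le> count_above c d"
proof -
  define J where "J = {j :: 'k. idx j < length d \<and> c < d ! idx j}"
  define f where "f x = (\<chi> j. if j \<in> J then (transpose V *v x) $ j else 0)" for x :: "real ^ 'k"
  have len: "length d = min CARD('n) CARD('k)"
    using svd by (simp add: is_svd_def)
  have lin: "linear f"
    by (rule linearI) (auto simp: f_def vec_eq_iff matrix_vector_right_distrib matrix_vector_mult_scaleR)
  have zero: "x = 0" if "x \<in> S" "f x = 0" for x
  proof (rule ccontr)
    assume "x \<noteq> 0"
    let ?y = "transpose V *v x"
    have y0: "?y $ j = 0" if "j \<in> J" for j
    proof -
      have "f x $ j = 0" using \<open>f x = 0\<close> by simp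
      then show ?thesis using that by (simp add: f_def)
    qed
    have "norm (X *v x) \<le> c * norm x"
      using y0 by (intro norm_svd_mult_le[OF svd \<open>0 \<le> c\<close>]) (force simp: J_def)
    then show False using large[OF \<open>x \<in> S\<close> \<open>x \<noteq> 0\<close>] by simp
  qed
  have "inj_on f (span S)"
    using zero \<open>subspace S\<close> linear_inj_on_iff_eq_0[OF lin, of S]
    by (simp add: span_eq_iff[THEN iffD2, OF \<open>subspace S\<close>])
  then have "dim S = dim (f ` S)"
    using dim_image_eq[OF lin] by metis
  also have "\<dots> \<le> dim {y :: real ^ 'k. \<forall>j. j \<notin> J \<longrightarrow> y $ j = 0}"
    by (rule dim_subset) (auto simp: f_def)
  also have "\<dots> = count_above c d"
    unfolding dim_coordinate_subspace J_def by (rule card_idx_above) (simp add: len)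
  finally show ?thesis .
qed

text \<open>
  The bound is attained by the span of the right singular vectors whose value is above \<open>c\<close>.
\<close>

lemma ex_subspace_count_above:
  fixes X :: "real ^ 'k ^ 'n"
  assumes svd: "is_svd X U d V" and "0 \<le> c"
  obtains S where "subspace S" "dim S = count_above c d"
    "\<And>x. x \<in> S \<Longrightarrow> x \<noteq> 0 \<Longrightarrow> c * norm x < norm (X *v x)"
proof -
  define J where "J = {j :: 'k. idx j < length d \<and> c < d ! idx j}"
  define C where "C = {y :: real ^ 'k. \<forall>j. j \<notin> J \<longrightarrow> y $ j = 0}"
  have V: "orthogonal_matrix V" and len: "length d = min CARD('n) CARD('k)"
    using svd by (auto simp: is_svd_def)
  have VV: "transpose V *v (V *v y) = y" for y
    using V by (simp add: orthogonal_matrix_def matrix_vector_mul_assoc)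
  show thesis
  proof
    have "subspace C" by (auto simp: C_def subspace_def)
    then show "subspace ((*v) V ` C)" by (simp add: linear_subspace_image)
    have "inj_on ((*v) V) (span C)" by (metis VV inj_onI)
    then have "dim ((*v) V ` C) = dim C" by (intro dim_image_eq) auto
    also have "\<dots> = count_above c d"
      unfolding C_def dim_coordinate_subspace J_def by (rule card_idx_above) (simp add: len)
    finally show "dim ((*v) V ` C) = count_above c d" .
  next
    fix x assume "x \<in> (*v) V ` C" "x \<noteq> 0"
    then obtain y where y: "y \<in> C" "x = V *v y" by auto
    with \<open>x \<noteq> 0\<close> have "y \<noteq> 0" by auto
    then obtain j0 where j0: "y $ j0 \<noteq> 0" by (auto simp: vec_eq_iff)
    let ?w = "\<lambda>j. if idx j < length d then (d ! idx j)\<^sup>2 else 0"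
    have less: "c\<^sup>2 < ?w j" if "j \<in> J" for j
      using that \<open>0 \<le> c\<close> by (auto simp: J_def intro!: power_strict_mono)
    have "j0 \<in> J" using j0 y by (auto simp: C_def)
    have "(c * norm x)\<^sup>2 = (\<Sum>j\<in>UNIV. c\<^sup>2 * (y $ j)\<^sup>2)"
      using norm_square_sum[of y] norm_orthogonal_matrix_mult[OF V, of y] y(2)
      by (simp add: sum_distrib_left[symmetric] power_mult_distrib)
    also have "\<dots> < (\<Sum>j\<in>UNIV. ?w j * (y $ j)\<^sup>2)"
    proof (rule sum_strict_mono_ex1)
      show "\<forall>j\<in>UNIV. c\<^sup>2 * (y $ j)\<^sup>2 \<le> ?w j * (y $ j)\<^sup>2"
      proof
        fix j show "c\<^sup>2 * (y $ j)\<^sup>2 \<le> ?w j * (y $ j)\<^sup>2"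
        proof (cases "j \<in> J")
          case True
          from less[OF this] show ?thesis by (intro mult_right_mono) auto
        next
          case False
          then show ?thesis using y by (simp add: C_def)
        qed
      qed
      show "\<exists>j\<in>UNIV. c\<^sup>2 * (y $ j)\<^sup>2 < ?w j * (y $ j)\<^sup>2"
      proof
        show "c\<^sup>2 * (y $ j0)\<^sup>2 < ?w j0 * (y $ j0)\<^sup>2"
          using j0 by (intro mult_strict_right_mono less[OF \<open>j0 \<in> J\<close>]) simp
      qed simp
    qed simp
    also have "\<dots> = (norm (X *v x))\<^sup>2"
      unfolding norm_svd_mult[OF svd] y(2) VV ..
    finally show "c * norm x < norm (X *v x)"
      by (rule power_less_imp_less_base) simp
  qed
qed

lemma count_above_svd_unique:
  assumes "is_svd X U d V" "is_svd X U' d' V'" "0 \<le> c"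
  shows "count_above c d = count_above c d'"
  by (metis assms dim_le_count_above ex_subspace_count_above order_antisym)


section \<open>Existence of singular value decompositions\<close>

definition orthonormal_upto :: "nat \<Rightarrow> (nat \<Rightarrow> 'a::real_inner) \<Rightarrow> bool" where
  "orthonormal_upto m u \<longleftrightarrow> (\<forall>i<m. \<forall>j<m. u i \<bullet> u j = (if i = j then 1 else 0))"

lemma orthonormal_upto_Suc:
  assumes "orthonormal_upto m u" "norm a = 1" "\<forall>i<m. u i \<bullet> a = 0"
  shows "orthonormal_upto (Suc m) (u(m := a))"
  using assms by (auto simp: orthonormal_upto_def less_Suc_eq norm_eq_1 inner_commute)

lemma ex_unit_orthogonal:
  fixes u :: "nat \<Rightarrow> 'a::euclidean_space"
  assumes "m < DIM('a)"
  obtains a where "norm a = 1" "\<forall>i<m. u i \<bullet> a = 0"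
proof -
  have "dim (u ` {..<m}) \<le> card (u ` {..<m})" by (simp add: dim_le_card')
  also have "\<dots> \<le> m" using card_image_le[of "{..<m}" u] by simp
  finally have "dim (u ` {..<m}) < DIM('a)" using assms by simp
  then obtain x where x: "x \<noteq> 0" "\<And>y. y \<in> span (u ` {..<m}) \<Longrightarrow> orthogonal x y"
    using orthogonal_to_subspace_exists by blast
  show thesis
  proof
    show "norm (x /\<^sub>R norm x) = 1" using x(1) by simp
    show "\<forall>i<m. u i \<bullet> (x /\<^sub>R norm x) = 0"
    proof safe
      fix i assume "i < m"
      then have "u i \<in> span (u ` {..<m})" by (intro span_base) auto
      then show "u i \<bullet> (x /\<^sub>R norm x) = 0"
        using x(2)[of "u i"] by (simp add: orthogonal_def inner_commute)
    qed
  qed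
qed

lemma orthonormal_upto_extend:
  fixes u :: "nat \<Rightarrow> 'a::euclidean_space"
  assumes "orthonormal_upto m u" "m \<le> DIM('a)"
  obtains u' where "orthonormal_upto DIM('a) u'" "\<forall>i<m. u' i = u i"
proof -
  have "\<exists>u'. orthonormal_upto l u' \<and> (\<forall>i<m. u' i = u i)" if "m \<le> l" "l \<le> DIM('a)" for l
    using that
  proof (induction l rule: dec_induct)
    case base
    show ?case using assms by blast
  next
    case (step l)
    then obtain u' where u': "orthonormal_upto l u'" "\<forall>i<m. u' i = u i" by auto
    obtain a where "norm a = 1" "\<forall>i<l. u' i \<bullet> a = 0"
      using ex_unit_orthogonal[of l u'] step.prems by auto
    then have "orthonormal_upto (Suc l) (u'(l := a))"
      using u'(1) by (rule orthonormal_upto_Suc[rotated])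
    moreover have "\<forall>i<m. (u'(l := a)) i = u i" using u'(2) step.hyps by auto
    ultimately show ?case by blast
  qed
  then show thesis using that assms(2) by blast
qed

text \<open>
  This is the equality case of the Cauchy-Schwarz inequality: testing with \<open>w / norm w\<close> gives
  \<open>norm w \<le> c\<close>, so \<open>(norm (w - c b))\<^sup>2 = (norm w)\<^sup>2 - c\<^sup>2\<close> is at most 0. It replaces a
  stationarity argument for the maximizer below.
\<close>

lemma eq_scaleR_if_inner_max:
  fixes w b :: "'a::real_inner"
  assumes "subspace W" "w \<in> W" "norm b = 1" "w \<bullet> b = c"
    and max: "\<And>x. x \<in> W \<Longrightarrow> norm x = 1 \<Longrightarrow> w \<bullet> x \<le> c"
  shows "w = c *\<^sub>R b"
proof (cases "w = 0")
  case True
  then show ?thesis using assms(4) by auto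
next
  case False
  have "w /\<^sub>R norm w \<in> W" using assms(1,2) by (simp add: subspace_scale)
  then have "w \<bullet> (w /\<^sub>R norm w) \<le> c" using False by (intro max) auto
  also have "w \<bullet> (w /\<^sub>R norm w) = norm w"
    using False by (simp add: power2_norm_eq_inner[symmetric] power2_eq_square field_simps)
  finally have "(norm w)\<^sup>2 \<le> c\<^sup>2" by (intro power_mono) auto
  moreover have "b \<bullet> b = 1" using assms(3) by (simp add: norm_eq_1)
  ultimately have "(w - c *\<^sub>R b) \<bullet> (w - c *\<^sub>R b) \<le> 0"
    using assms(4)
    by (simp add: inner_diff_left inner_diff_right inner_commute[of b w] power2_norm_eq_inner
        power2_eq_square[of c])
  then show ?thesis by (metis inner_gt_zero_iff not_less right_minus_eq)
qed

lemma inner_transpose_mult: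
  fixes X :: "real ^ 'k ^ 'n"
  shows "(transpose X *v a) \<bullet> b = a \<bullet> (X *v b)"
  by (metis dot_lmul_matrix vector_transpose_matrix transpose_transpose)

text \<open>
  The first \<open>m\<close> columns of a decomposition under construction. Requiring that \<open>transpose X\<close> maps back
  makes the orthogonal complements of the \<open>u i\<close> and of the \<open>v i\<close> invariant, so that the
  construction can continue inside them.
\<close>

definition singular_system ::
    "real ^ 'k ^ 'n \<Rightarrow> nat \<Rightarrow> (nat \<Rightarrow> real ^ 'n) \<Rightarrow> (nat \<Rightarrow> real) \<Rightarrow> (nat \<Rightarrow> real ^ 'k) \<Rightarrow> bool" where
  "singular_system X m u d v \<longleftrightarrow>
     orthonormal_upto m u \<and> orthonormal_upto m v \<and>
     (\<forall>i<m. X *v v i = d i *\<^sub>R u i \<and> transpose X *v u i = d i *\<^sub>R v i \<and> 0 \<le> d i) \<and>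
     (\<forall>i<m. \<forall>j\<le>i. d i \<le> d j)"

text \<open>
  A maximizing pair of \<open>a \<bullet> X b\<close> exists by compactness. For fixed \<open>a\<close> the vector \<open>b\<close>
  maximizes \<open>transpose X a \<bullet> b\<close>, and for fixed \<open>b\<close> the vector \<open>a\<close> maximizes \<open>X b \<bullet> a\<close>; so each
  image is a multiple of the other vector.
\<close>

lemma ex_singular_pair:
  fixes X :: "real ^ 'k ^ 'n"
  assumes sys: "singular_system X m u d v" and m: "m < CARD('n)" "m < CARD('k)"
  obtains a c b where "norm a = 1" "norm b = 1" "\<forall>i<m. u i \<bullet> a = 0" "\<forall>i<m. v i \<bullet> b = 0"
    "X *v b = c *\<^sub>R a" "transpose X *v a = c *\<^sub>R b" "0 \<le> c"
    "\<And>a' b'. norm a' = 1 \<Longrightarrow> norm b' = 1 \<Longrightarrow> \<forall>i<m. u i \<bullet> a' = 0 \<Longrightarrow> \<forall>i<m. v i \<bullet> b' = 0 \<Longrightarrow>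
       a' \<bullet> (X *v b') \<le> c"
proof -
  define A where "A = {a. \<forall>i<m. u i \<bullet> a = 0}"
  define B where "B = {b. \<forall>i<m. v i \<bullet> b = 0}"
  have sub: "subspace A" "subspace B"
    by (auto simp: A_def B_def subspace_def inner_add_right)
  have "closed A" "closed B"
    unfolding A_def B_def by (auto intro!: closed_Collect_all closed_Collect_imp closed_Collect_eq continuous_intros)
  then have "compact (sphere 0 1 \<inter> A)" "compact (sphere 0 1 \<inter> B)"
    by (auto intro: compact_Int_closed)
  then have "compact ((sphere 0 1 \<inter> A) \<times> (sphere 0 1 \<inter> B))" by (rule compact_Times)
  moreover obtain a0 where a0: "norm a0 = 1" "a0 \<in> A"
    using ex_unit_orthogonal[of m u] m by (auto simp: A_def)
  moreover obtain b0 where b0: "norm b0 = 1" "b0 \<in> B"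
    using ex_unit_orthogonal[of m v] m by (auto simp: B_def)
  moreover have "continuous_on ((sphere 0 1 \<inter> A) \<times> (sphere 0 1 \<inter> B)) (\<lambda>p. fst p \<bullet> (X *v snd p))"
    by (intro continuous_intros linear_continuous_on_compose[where g="(*v) X"]) auto
  ultimately obtain p where p: "p \<in> (sphere 0 1 \<inter> A) \<times> (sphere 0 1 \<inter> B)"
      "\<forall>q\<in>(sphere 0 1 \<inter> A) \<times> (sphere 0 1 \<inter> B). fst q \<bullet> (X *v snd q) \<le> fst p \<bullet> (X *v snd p)"
    using continuous_attains_sup[of "(sphere 0 1 \<inter> A) \<times> (sphere 0 1 \<inter> B)" "\<lambda>p. fst p \<bullet> (X *v snd p)"]
    by fastforce
  obtain a b where ab: "p = (a, b)" by fastforce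
  define c where "c = a \<bullet> (X *v b)"
  have a: "norm a = 1" "a \<in> A" and b: "norm b = 1" "b \<in> B" using p(1) ab by auto
  have max: "a' \<bullet> (X *v b') \<le> c" if "norm a' = 1" "a' \<in> A" "norm b' = 1" "b' \<in> B" for a' b'
    using p(2) that by (auto simp: ab c_def)
  have sys': "X *v v i = d i *\<^sub>R u i" "transpose X *v u i = d i *\<^sub>R v i" if "i < m" for i
    using sys that by (auto simp: singular_system_def)
  have XB: "X *v b \<in> A"
    using b sys'(2) by (auto simp: A_def B_def inner_transpose_mult[symmetric])
  have XA: "transpose X *v a \<in> B"
    using a sys'(1) inner_transpose_mult[of X a "v _"]
    by (simp add: A_def B_def inner_commute)
  have "X *v b = c *\<^sub>R a"
    using eq_scaleR_if_inner_max[OF sub(1) XB a(1), of c] max b by (simp add: c_def inner_commute)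
  moreover have "transpose X *v a = c *\<^sub>R b"
    using eq_scaleR_if_inner_max[OF sub(2) XA b(1), of c] max a by (simp add: c_def inner_transpose_mult)
  \<comment> \<open>The feasible set is symmetric, so the maximum is also at least \<open>- c\<close>.\<close>
  moreover have "0 \<le> c"
    using max[of "- a" b] a b subspace_neg[OF sub(1)] by (simp add: c_def)
  moreover have "a' \<bullet> (X *v b') \<le> c"
    if "norm a' = 1" "norm b' = 1" "\<forall>i<m. u i \<bullet> a' = 0" "\<forall>i<m. v i \<bullet> b' = 0" for a' b'
    using max[of a' b'] that by (simp add: A_def B_def)
  moreover have "\<forall>i<m. u i \<bullet> a = 0" "\<forall>i<m. v i \<bullet> b = 0" using a(2) b(2) by (simp_all add: A_def B_def)
  ultimately show thesis
    using that[of a b c] a(1) b(1) by blast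
qed

text \<open>
  The second conjunct, that every \<open>d i\<close> bounds the form on the remaining complements, is the
  invariant which makes the next singular value at most the previous ones.
\<close>

lemma ex_singular_system:
  fixes X :: "real ^ 'k ^ 'n"
  assumes "m \<le> CARD('n)" "m \<le> CARD('k)"
  shows "\<exists>u d v. singular_system X m u d v \<and>
    (\<forall>i<m. \<forall>a b. norm a = 1 \<longrightarrow> norm b = 1 \<longrightarrow> (\<forall>l<m. u l \<bullet> a = 0) \<longrightarrow> (\<forall>l<m. v l \<bullet> b = 0) \<longrightarrow>
       a \<bullet> (X *v b) \<le> d i)"
  using assms
proof (induction m)
  case 0
  show ?case by (simp add: singular_system_def orthonormal_upto_def)
next
  case (Suc m)
  then obtain u d v where sys: "singular_system X m u d v"
    and dom: "\<And>i a b. i < m \<Longrightarrow> norm a = 1 \<Longrightarrow> norm b = 1 \<Longrightarrow> \<forall>l<m. u l \<bullet> a = 0 \<Longrightarrow>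
      \<forall>l<m. v l \<bullet> b = 0 \<Longrightarrow> a \<bullet> (X *v b) \<le> d i"
    by auto
  from Suc.prems have "m < CARD('n)" "m < CARD('k)" by auto
  from ex_singular_pair[OF sys this] obtain a c b where
    ab: "norm a = 1" "norm b = 1" "\<forall>i<m. u i \<bullet> a = 0" "\<forall>i<m. v i \<bullet> b = 0"
    "X *v b = c *\<^sub>R a" "transpose X *v a = c *\<^sub>R b" "0 \<le> c"
    and max: "\<And>a' b'. norm a' = 1 \<Longrightarrow> norm b' = 1 \<Longrightarrow> \<forall>i<m. u i \<bullet> a' = 0 \<Longrightarrow>
       \<forall>i<m. v i \<bullet> b' = 0 \<Longrightarrow> a' \<bullet> (X *v b') \<le> c"
    by metis
  let ?u = "u(m := a)" and ?d = "d(m := c)" and ?v = "v(m := b)"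
  have "a \<bullet> (X *v b) = c" using ab(1,5) by (simp add: norm_eq_1)
  then have "c \<le> d i" if "i < m" for i using dom[OF that ab(1-4)] by simp
  then have "singular_system X (Suc m) ?u ?d ?v"
    using sys ab orthonormal_upto_Suc[of m u a] orthonormal_upto_Suc[of m v b]
    by (auto simp: singular_system_def less_Suc_eq)
  moreover have "x \<bullet> (X *v y) \<le> ?d i"
    if "i < Suc m" "norm x = 1" "norm y = 1" "\<forall>l<Suc m. ?u l \<bullet> x = 0" "\<forall>l<Suc m. ?v l \<bullet> y = 0" for i x y
  proof -
    have "\<forall>l<m. u l \<bullet> x = 0" "\<forall>l<m. v l \<bullet> y = 0"
      using that(4,5) by (metis fun_upd_apply less_Suc_eq less_irrefl)+
    then show ?thesis using max dom that(1-3) by (cases "i = m") auto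
  qed
  ultimately show ?case by blast
qed

lemma orthogonal_matrix_of_orthonormal:
  fixes u :: "nat \<Rightarrow> real ^ 'n"
  assumes "orthonormal_upto CARD('n) u"
  shows "orthogonal_matrix (\<chi> r j. u (idx j) $ r)"
proof -
  have "column j (\<chi> r j. u (idx j) $ r) = u (idx j)" for j :: 'n by (simp add: column_def vec_eq_iff)
  then show ?thesis
    using assms idx_less[where 'a='n]
    by (simp add: orthogonal_matrix_orthonormal_columns orthonormal_upto_def norm_eq_1 orthogonal_def)
qed

text \<open>
  Both orthonormal families are completed to bases. In \<open>transpose U ** X ** V\<close> an entry
  \<open>u i \<bullet> X v j\<close> is known as soon as one of \<open>i\<close> and \<open>j\<close> is below \<open>m = min n k\<close>, and one of them
  always is.
\<close>

lemma ex_sorted_svd: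
  fixes X :: "real ^ 'k ^ 'n"
  obtains U d V where "is_svd X U d V" "sorted_wrt (\<ge>) d"
proof -
  define m where "m = min CARD('n) CARD('k)"
  have "m \<le> CARD('n)" "m \<le> CARD('k)" by (auto simp: m_def)
  then obtain u0 d v0 where sys: "singular_system X m u0 d v0"
    using ex_singular_system[of m X] by blast
  obtain u where u: "orthonormal_upto CARD('n) u" "\<forall>i<m. u i = u0 i"
    using orthonormal_upto_extend[of m u0] sys by (auto simp: singular_system_def m_def)
  obtain v where v: "orthonormal_upto CARD('k) v" "\<forall>i<m. v i = v0 i"
    using orthonormal_upto_extend[of m v0] sys by (auto simp: singular_system_def m_def)
  have pair: "X *v v i = d i *\<^sub>R u i" "transpose X *v u i = d i *\<^sub>R v i" "0 \<le> d i" if "i < m" for i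
    using sys u(2) v(2) that by (auto simp: singular_system_def)
  let ?U = "(\<chi> r j. u (idx j) $ r) :: real ^ 'n ^ 'n"
    and ?V = "(\<chi> r j. v (idx j) $ r) :: real ^ 'k ^ 'k" and ?d = "map d [0..<m]"
  have U: "orthogonal_matrix ?U" and V: "orthogonal_matrix ?V"
    using u v by (auto intro: orthogonal_matrix_of_orthonormal)
  have diag: "transpose ?U ** (X ** ?V) = rect_diag ?d"
  proof -
    have "(transpose ?U ** (X ** ?V)) $ i $ j = u (idx i) \<bullet> (X *v v (idx j))" for i :: 'n and j :: 'k
      by (simp add: matrix_matrix_mult_def matrix_vector_mult_def transpose_def inner_vec_def)
    moreover have "u (idx i) \<bullet> (X *v v (idx j)) = (if idx i = idx j then ?d ! idx i else 0)"
      for i :: 'n and j :: 'k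
    proof (cases "idx i < m")
      case True
      then have "u (idx i) \<bullet> (X *v v (idx j)) = d (idx i) * (v (idx i) \<bullet> v (idx j))"
        by (simp add: inner_transpose_mult[symmetric] pair)
      then show ?thesis using True v(1) idx_less[of j] by (auto simp: orthonormal_upto_def m_def)
    next
      case False
      then have "idx j < m" "idx i \<noteq> idx j" using idx_less[of j] idx_less[of i] by (auto simp: m_def)
      then show ?thesis using u(1) idx_less[of i] by (auto simp: pair orthonormal_upto_def m_def)
    qed
    ultimately show ?thesis by (simp add: vec_eq_iff rect_diag_def)
  qed
  have "?U ** rect_diag ?d ** transpose ?V = (?U ** transpose ?U) ** X ** (?V ** transpose ?V)"
    by (simp add: diag[symmetric] matrix_mul_assoc)
  then have "X = ?U ** rect_diag ?d ** transpose ?V"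
    using U V by (simp add: orthogonal_matrix_def)
  then have "is_svd X ?U ?d ?V"
    using U V pair(3) by (auto simp: is_svd_def m_def)
  moreover have "sorted_wrt (\<ge>) ?d"
    using sys by (auto simp: sorted_wrt_iff_nth_less singular_system_def)
  ultimately show thesis by (rule that)
qed

section \<open>Singular values, their support and the spectral norm\<close>

lemma singular_values_svd:
  fixes X :: "real ^ 'k ^ 'n"
  obtains U V where "is_svd X U (singular_values X) V" "sorted_wrt (\<ge>) (singular_values X)"
proof -
  have "\<exists>!d. sorted_wrt (\<ge>) d \<and> (\<exists>U V. is_svd X U d V)"
  proof (rule ex_ex1I)
    show "\<exists>d. sorted_wrt (\<ge>) d \<and> (\<exists>U V. is_svd X U d V)" using ex_sorted_svd[of X] by metis
    show "d = e" if "sorted_wrt (\<ge>) d \<and> (\<exists>U V. is_svd X U d V)"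
      "sorted_wrt (\<ge>) e \<and> (\<exists>U V. is_svd X U e V)" for d e
    proof (rule sorted_eq_if_count_above_eq)
      from that obtain U V U' V' where svd: "is_svd X U d V" "is_svd X U' e V'" by blast
      then show "count_above c d = count_above c e" if "0 \<le> c" for c
        using that by (rule count_above_svd_unique)
    qed (use that in \<open>auto simp: is_svd_def\<close>)
  qed
  from theI'[OF this] show thesis using that unfolding singular_values_def by blast
qed

text \<open>
  The support can thus be read off from any decomposition, sorted or not; thresholding, for one,
  starts from an arbitrary one.
\<close>

lemma supp_singular_values:
  fixes X :: "real ^ 'k ^ 'n"
  assumes "is_svd X U d V"
  shows "supp (singular_values X) = {..<count_above 0 d}"
proof -
  obtain U' V' where svd: "is_svd X U' (singular_values X) V'" "sorted_wrt (\<ge>) (singular_values X)"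
    by (rule singular_values_svd)
  then have "supp (singular_values X) = {i. i < length (singular_values X) \<and> 0 < singular_values X ! i}"
    by (force simp: supp_def is_svd_def set_conv_nth)
  also have "\<dots> = {..<count_above 0 (singular_values X)}" using svd(2) by (rule sorted_above_eq)
  also have "count_above 0 (singular_values X) = count_above 0 d"
    using count_above_svd_unique[OF svd(1) assms] by simp
  finally show ?thesis .
qed

lemma norm_mult_le_sigma_max:
  fixes X :: "real ^ 'k ^ 'n"
  shows "norm (X *v x) \<le> sigma_max X * norm x"
proof -
  obtain U V where svd: "is_svd X U (singular_values X) V" by (rule singular_values_svd)
  let ?d = "singular_values X"
  have le: "?d ! i \<le> sigma_max X" if "i < length ?d" for i
    using that by (simp add: sigma_max_def)
  have "0 < length ?d" "\<forall>x\<in>set ?d. 0 \<le> x" using svd by (auto simp: is_svd_def)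
  with le[of 0] have "0 \<le> sigma_max X" by (meson nth_mem order_trans)
  then show ?thesis by (rule norm_svd_mult_le[OF svd]) (rule le)
qed

section \<open>Rank after projection and thresholding\<close>

text \<open>
  The case \<open>\<sigma>(W) = 0\<close> of Weyl's inequality, in terms of counts: a subspace on which \<open>W - D\<close>
  stretches by more than \<open>\<theta>\<close> meets the kernel of \<open>W\<close> only in 0, because \<open>D\<close> stretches by at most \<open>\<theta>\<close>.
\<close>

lemma count_above_perturbation_le:
  fixes W D :: "real ^ 'k ^ 'n"
  assumes W: "is_svd W A e B" and Q: "is_svd (W - D) U d V"
    and "0 \<le> \<theta>" and D: "\<And>x. norm (D *v x) \<le> \<theta> * norm x"
  shows "count_above \<theta> d \<le> count_above 0 e"
proof -
  obtain S where S: "subspace S" "dim S = count_above \<theta> d"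
    "\<And>x. x \<in> S \<Longrightarrow> x \<noteq> 0 \<Longrightarrow> \<theta> * norm x < norm ((W - D) *v x)"
    using ex_subspace_count_above[OF Q \<open>0 \<le> \<theta>\<close>] by blast
  have "0 * norm x < norm (W *v x)" if "x \<in> S" "x \<noteq> 0" for x
  proof -
    have diff: "(W - D) *v x = W *v x - D *v x" by (rule matrix_vector_mult_diff_rdistrib)
    have "0 < norm (W *v x)"
      using S(3)[OF that, unfolded diff] norm_triangle_ineq4[of "W *v x" "D *v x"] D[of x] by linarith
    then show ?thesis by simp
  qed
  then show ?thesis using dim_le_count_above[OF W _ S(1)] S(2) by simp
qed

text \<open>
  Zeroing singular values keeps the orthogonal factors, so the given decompositions of the inputs
  are decompositions of the outputs as well, though not necessarily sorted ones.
\<close>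

lemma supp_hard_threshold_subset:
  fixes W D Y :: "real ^ 'k ^ 'n"
  assumes proj: "support_proj {..<r} T W" and thr: "hard_threshold \<theta> (W - D) Y"
    and "0 \<le> \<theta>" and D: "\<And>x. norm (D *v x) \<le> \<theta> * norm x"
  shows "supp (singular_values Y) \<subseteq> {..<r}"
proof -
  from proj obtain A e B where T: "is_svd T A e B"
    and W: "W = A ** rect_diag (map (\<lambda>i. if i \<in> {..<r} then e ! i else 0) [0..<length e]) ** transpose B"
    unfolding support_proj_def by blast
  let ?e = "map (\<lambda>i. if i \<in> {..<r} then e ! i else 0) [0..<length e]"
  have svd_W: "is_svd W A ?e B" using T W by (auto simp: is_svd_def)
  have "count_above 0 ?e \<le> card {..<r}"
    unfolding count_above_def by (rule card_mono) (auto split: if_splits)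
  then have rank_W: "count_above 0 ?e \<le> r" by simp
  from thr obtain U d V where Q: "is_svd (W - D) U d V"
    and Y: "Y = U ** rect_diag (map (\<lambda>x. if \<bar>x\<bar> \<le> \<theta> then 0 else x) d) ** transpose V"
    unfolding hard_threshold_def by blast
  let ?d = "map (\<lambda>x. if \<bar>x\<bar> \<le> \<theta> then 0 else x) d"
  have svd_Y: "is_svd Y U ?d V" using Q Y by (auto simp: is_svd_def)
  have nonneg: "0 \<le> d ! i" if "i < length d" for i using Q that by (auto simp: is_svd_def)
  have "{i. i < length ?d \<and> 0 < ?d ! i} = {i. i < length d \<and> \<theta> < d ! i}"
    using \<open>0 \<le> \<theta>\<close> nonneg by (force split: if_splits)
  then have "count_above 0 ?d = count_above \<theta> d" by (simp only: count_above_def)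
  also have "\<dots> \<le> r"
    using count_above_perturbation_le[OF svd_W Q \<open>0 \<le> \<theta>\<close> D] rank_W by linarith
  finally show ?thesis unfolding supp_singular_values[OF svd_Y] by auto
qed

theorem lemma2p7:
  fixes g :: "real ^ 'k ^ 'n \<Rightarrow> real"
    and grad :: "real ^ 'k ^ 'n \<Rightarrow> real ^ 'k ^ 'n"
    and G L lam s :: real
    and X :: "nat \<Rightarrow> real ^ 'k ^ 'n"
  assumes "convex_on UNIV g"
    and "\<And>Y. GDERIV g Y :> grad Y"
    and "G > 0" and "\<And>Y. sigma_max (grad Y) \<le> G"
    and "L > 0" and "\<And>Y Z. norm (grad Y - grad Z) \<le> L * norm (Y - Z)"
    and "lam > 0"
    and "s > 0" and "s \<le> min (2 * lam / G\<^sup>2) (1 / L)"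
    and "apg_support_proj_seq grad lam s X"
  shows "\<forall>t\<ge>1. supp (singular_values (X (t + 1))) \<subseteq> supp (singular_values (X t))"
proof (intro allI impI)
  fix t :: nat assume "1 \<le> t"
  then obtain T W where
    proj: "support_proj (supp (singular_values (X t))) T W" and
    thr: "hard_threshold (sqrt (2 * lam * s)) (W - s *\<^sub>R grad W) (X (t + 1))"
    using assms(10) unfolding apg_support_proj_seq_def by blast
  obtain U V where "is_svd (X t) U (singular_values (X t)) V" by (rule singular_values_svd)
  then have supp: "supp (singular_values (X t)) = {..<count_above 0 (singular_values (X t))}"
    by (rule supp_singular_values)
  \<comment> \<open>The step size is chosen such that a gradient step moves singular values at most by the threshold.\<close>
  have "s * G\<^sup>2 \<le> 2 * lam" using assms(3,9) by (simp add: field_simps)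
  then have "s * (s * G\<^sup>2) \<le> s * (2 * lam)" using assms(8) by (intro mult_left_mono) auto
  then have step: "s * G \<le> sqrt (2 * lam * s)"
    by (intro real_le_rsqrt) (simp add: power2_eq_square algebra_simps)
  have "norm ((s *\<^sub>R grad W) *v x) \<le> sqrt (2 * lam * s) * norm x" for x
  proof -
    have "norm ((s *\<^sub>R grad W) *v x) = s * norm (grad W *v x)"
      using assms(8) by (simp add: scaleR_matrix_vector_assoc[symmetric])
    also have "\<dots> \<le> s * (G * norm x)"
      using norm_mult_le_sigma_max[of "grad W" x] mult_right_mono[OF assms(4)[of W], of "norm x"] assms(8)
      by (intro mult_left_mono) auto
    also have "\<dots> \<le> sqrt (2 * lam * s) * norm x"
      using mult_right_mono[OF step, of "norm x"] by (simp add: mult.assoc)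
    finally show ?thesis .
  qed
  then show "supp (singular_values (X (t + 1))) \<subseteq> supp (singular_values (X t))"
    using supp_hard_threshold_subset[OF proj[unfolded supp] thr] assms(7,8) by (simp add: supp)
qed

end
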